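(* Let $\alpha,\beta$ be positive integers with $\gcd(\alpha,\beta)=1$ and $\alpha<\beta$, and let $\omega_1=\frac{\alpha}{\beta}\pi$. (i) For every $M\in\mathcal{M}$ with $M(e^{j\omega_1})\neq 0$, $$\left|\angle M(e^{j\omega_1})\right|\le \frac{\pi}{2}\left(1-\frac{1}{\beta}\right)\quad\text{when }\alpha\text{ is odd},$$ $$\left|\angle M(e^{j\omega_1})\right|\le \frac{\pi}{2}\left(1-\frac{2}{\beta}\right)\quad\text{when }\alpha\text{ is even}.$$ (ii) For every $M\in\mathcal{M}_{\text{odd}}$ with $M(e^{j\omega_1})\neq 0$, $$\left|\angle M(e^{j\omega_1})\right|\le \frac{\pi}{2}\left(1-\frac{1}{\beta}\right).$$ (iii) For every $M\in\mathcal{M}_{\text{odd}}$ with $M(e^{j\pi})\neq 0$, $\angle M(e^{j\pi})=0$.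
   Context: $j$ is the imaginary unit and $\angle w\in(-\pi,\pi]$ is the argument of a nonzero complex number $w$. For a real two-sided sequence $h=(h_i)_{i\in\mathbb{Z}}$, $\|h\|_1=\sum_{i\in\mathbb{Z}}|h_i|$. Discrete-time LTI Zames-Falb multipliers: $\mathcal{M}$ is the set of functions on the unit circle of the form $M(e^{j\omega})=1-H(e^{j\omega})$, $H(e^{j\omega})=\sum_{i\in\mathbb{Z}}h_ie^{-j\omega i}$, where $h$ is a real sequence with $h_0=0$, $h_i\ge 0$ for all $i$ and $\|h\|_1\le 1$. $\mathcal{M}_{\text{odd}}$ is the set of such functions where $h$ is a real sequence with $h_0=0$ and $\|h\|_1\le 1$ (no sign condition). *)

theory Defs
  imports "HOL-Analysis.Analysis"
begin

(* infsum of a non-summable family is 0, so finiteness of the l1 norm has to be required explicitly. *)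
definition l1_norm_le_one :: "(int \<Rightarrow> real) \<Rightarrow> bool"
  where "l1_norm_le_one h \<longleftrightarrow>
    (\<lambda>i. \<bar>h i\<bar>) summable_on UNIV \<and> (\<Sum>\<^sub>\<infinity>i. \<bar>h i\<bar>) \<le> 1"

definition freq_response :: "(int \<Rightarrow> real) \<Rightarrow> real \<Rightarrow> complex"
  where "freq_response h \<omega> =
    (\<Sum>\<^sub>\<infinity>i. complex_of_real (h i) * exp (- (\<i> * complex_of_real \<omega> * of_int i)))"

(* Multipliers are functions on the unit circle: elements of the two sets below are constrained
   only at the points exp (i omega), their values elsewhere are irrelevant. *)
definition ZF_multipliers :: "(complex \<Rightarrow> complex) set"
  where "ZF_multipliers =
    {M. \<exists>h. h 0 = 0 \<and> (\<forall>i. 0 \<le> h i) \<and> l1_norm_le_one h \<and>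
        (\<forall>\<omega>::real. M (exp (\<i> * complex_of_real \<omega>)) = 1 - freq_response h \<omega>)}"

definition ZF_multipliers_odd :: "(complex \<Rightarrow> complex) set"
  where "ZF_multipliers_odd =
    {M. \<exists>h. h 0 = 0 \<and> l1_norm_le_one h \<and>
        (\<forall>\<omega>::real. M (exp (\<i> * complex_of_real \<omega>)) = 1 - freq_response h \<omega>)}"

end

theory Submission
  imports Defs
begin

text \<open>
  At the frequency \<open>\<omega>\<^sub>1\<close> the number \<open>H\<close> is a subconvex combination of \<open>N\<close>-th roots of unity,
  where \<open>N = \<beta>\<close> for nonnegative \<open>h\<close> and even \<open>\<alpha>\<close>, and \<open>N = 2\<beta>\<close> otherwise (a sign change maps
  \<open>2\<beta>\<close>-th roots of unity to \<open>2\<beta>\<close>-th roots of unity). The regular \<open>N\<close>-gon spanned by these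
  roots has the vertex 1, and its two edges at 1 have the outer normals \<open>cis (\<plusminus> pi / N)\<close>; hence
  \<open>1 - H\<close> lies in the cone of half-angle \<open>pi / 2 - pi / N\<close> around the positive real axis.
\<close>

lemma cos_int_multiple_le:
  fixes n N :: int
  assumes "0 < N" and "\<not> 2 * N dvd n"
  shows "cos (of_int n * pi / of_int N) \<le> cos (pi / of_int N)"
proof -
  \<comment> \<open>A period shift replaces \<open>n\<close> by its nonzero residue \<open>m\<close>
    modulo \<open>2 * N\<close>. Since \<open>m\<close> lies between 1 and \<open>2 * N - 1\<close>,
    the angle \<open>x\<close> keeps distance at least \<open>pi / N\<close> from both ends of the
    interval from 0 to \<open>2 * pi\<close>, where cosine peaks.\<close>
  define m where "m = n mod (2 * N)"
  have m: "1 \<le> m" "m \<le> 2 * N - 1"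
  proof -
    have "0 \<le> m" "m < 2 * N" "m \<noteq> 0"
      using assms by (auto simp: m_def dvd_eq_mod_eq_0)
    then show "1 \<le> m" "m \<le> 2 * N - 1" by linarith+
  qed
  define x where "x = of_int m * pi / of_int N"
  have N: "(0::real) < of_int N" using assms by simp
  have "n = n div (2 * N) * (2 * N) + m"
    by (simp only: m_def div_mult_mod_eq)
  then have "(of_int n :: real) = of_int (n div (2 * N)) * (2 * of_int N) + of_int m"
    by (metis of_int_add of_int_mult of_int_numeral)
  then have "of_int n * pi / of_int N = x + of_int (n div (2 * N)) * (2 * pi)"
    using N by (simp add: x_def field_simps)
  then have cx: "cos (of_int n * pi / of_int N) = cos x"
    using cos.plus_of_int[of x "n div (2 * N)"] by simp
  have m': "1 \<le> (of_int m :: real)" "(of_int m :: real) \<le> 2 * of_int N - 1"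
    using m by linarith+
  have lo: "pi / of_int N \<le> x"
    using m'(1) N by (simp add: x_def divide_right_mono)
  have "of_int m * pi \<le> (2 * of_int N - 1) * pi"
    using m'(2) by (intro mult_right_mono) auto
  then have hi: "x \<le> 2 * pi - pi / of_int N"
    using N by (simp add: x_def field_simps)
  have pos: "0 \<le> pi / of_int N" using N by simp
  have "cos x \<le> cos (pi / of_int N)"
  proof (cases "x \<le> pi")
    case True
    then show ?thesis using lo pos by (intro cos_monotone_0_pi_le) auto
  next
    case False
    \<comment> \<open>Reflection at pi returns the angle to the range where cosine
      decreases.\<close>
    then have "cos (2 * pi - x) \<le> cos (pi / of_int N)"
      using hi pos by (intro cos_monotone_0_pi_le) auto
    then show ?thesis by (simp add: cos_diff)
  qed
  then show ?thesis using cx by simp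
qed

text \<open>The half-planes give nonnegative cosines at \<open>Arg w + \<phi>\<close> and
  \<open>Arg w - \<phi>\<close>. Cosine being even, the one matching the sign of
  \<open>Arg w\<close> reads \<open>0 \<le> cos (\<bar>Arg w\<bar> + \<phi>)\<close>.\<close>

lemma abs_Arg_le_of_half_planes:
  assumes "w \<noteq> 0" and "0 \<le> \<phi>" and "\<phi> < pi / 2"
    and "0 \<le> Re (w * cis \<phi>)" and "0 \<le> Re (w * cis (- \<phi>))"
  shows "\<bar>Arg w\<bar> \<le> pi / 2 - \<phi>"
proof -
  have w: "w = of_real (cmod w) * cis (Arg w)"
    using Arg_eq[OF assms(1)] by (simp add: cis_conv_exp)
  have "0 \<le> cos (Arg w + s)" if "0 \<le> Re (w * cis s)" for s
  proof -
    have "Re (w * cis s) = cmod w * cos (Arg w + s)"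
      by (subst w) (simp add: mult.assoc cis_mult)
    then show ?thesis using that assms(1) by (simp add: zero_le_mult_iff)
  qed
  from this[OF assms(4)] this[OF assms(5)]
  have c: "0 \<le> cos (\<bar>Arg w\<bar> + \<phi>)"
    by (cases "0 \<le> Arg w") (auto simp: cos_add cos_diff mult.commute)
  show ?thesis
  proof (rule ccontr)
    assume "\<not> ?thesis"
    moreover have "\<bar>Arg w\<bar> \<le> pi"
      using mpi_less_Arg[of w] Arg_le_pi[of w] by linarith
    \<comment> \<open>Otherwise the sum lies strictly between \<open>pi / 2\<close> and
      \<open>3 * pi / 2\<close>, where cosine is negative.\<close>
    ultimately have "\<bar>\<bar>Arg w\<bar> + \<phi> - pi\<bar> < pi / 2"
      using assms(3) unfolding abs_less_iff by linarith
    then have "0 < cos (\<bar>Arg w\<bar> + \<phi> - pi)"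
      unfolding abs_less_iff by (intro cos_gt_zero_pi) linarith+
    then show False using c by (simp add: cos_diff)
  qed
qed

text \<open>Summing the termwise bounds gives at most \<open>cos \<phi>\<close> times the l1 norm of
  \<open>h\<close>, hence at most \<open>cos \<phi>\<close>, which is the real part of
  \<open>cis \<phi>\<close>.\<close>

lemma Re_one_minus_freq_response_nonneg:
  assumes l1: "l1_norm_le_one h" and c: "0 \<le> cos \<phi>"
    and le: "\<And>i. h i * cos (\<phi> - \<omega> * of_int i) \<le> \<bar>h i\<bar> * cos \<phi>"
  shows "0 \<le> Re ((1 - freq_response h \<omega>) * cis \<phi>)"
proof -
  let ?f = "\<lambda>i. complex_of_real (h i) * exp (- (\<i> * complex_of_real \<omega> * of_int i))"
  have abs: "(\<lambda>i. \<bar>h i\<bar>) summable_on UNIV" and one: "(\<Sum>\<^sub>\<infinity>i. \<bar>h i\<bar>) \<le> 1"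
    using l1 by (auto simp: l1_norm_le_one_def)
  have summand: "?f i * cis \<phi> = of_real (h i) * cis (\<phi> - \<omega> * of_int i)" for i
    by (simp add: cis_conv_exp mult.assoc flip: exp_add) (simp add: algebra_simps)
  have "(\<lambda>i. norm (?f i)) = (\<lambda>i. \<bar>h i\<bar>)"
    by (simp add: norm_mult)
  then have sf: "?f summable_on UNIV"
    using abs by (metis abs_summable_summable)
  then have sg: "(\<lambda>i. ?f i * cis \<phi>) summable_on UNIV"
    by (rule summable_on_cmult_left)
  have "Re (freq_response h \<omega> * cis \<phi>) = Re (\<Sum>\<^sub>\<infinity>i. ?f i * cis \<phi>)"
    unfolding freq_response_def by (subst infsum_cmult_left) (use sf in auto)
  also have "\<dots> = (\<Sum>\<^sub>\<infinity>i. Re (?f i * cis \<phi>))"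
    using sg by (rule infsum_Re[symmetric])
  also have "\<dots> \<le> (\<Sum>\<^sub>\<infinity>i. \<bar>h i\<bar> * cos \<phi>)"
  proof (rule infsum_mono)
    show "(\<lambda>i. Re (?f i * cis \<phi>)) summable_on UNIV"
      using sg by (rule summable_on_Re)
    show "(\<lambda>i. \<bar>h i\<bar> * cos \<phi>) summable_on UNIV"
      using abs by (rule summable_on_cmult_left)
    show "Re (?f i * cis \<phi>) \<le> \<bar>h i\<bar> * cos \<phi>" for i
      unfolding summand using le[of i] by simp
  qed
  also have "\<dots> = (\<Sum>\<^sub>\<infinity>i. \<bar>h i\<bar>) * cos \<phi>"
    using abs by (intro infsum_cmult_left) auto
  also have "\<dots> \<le> cos \<phi>"
    using mult_right_mono[OF one c] by simp
  finally show ?thesis by (simp add: left_diff_distrib)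
qed

text \<open>Reduces the sector bound to a termwise inequality. The values 1 and -1 of
  \<open>e\<close> stand for the two edges of the polygon at 1, and \<open>2 < N\<close> keeps the
  angles of their normals below \<open>pi / 2\<close>.\<close>

lemma abs_Arg_one_minus_freq_response_le:
  fixes N :: int
  assumes l1: "l1_norm_le_one h" and N: "2 < N" and nz: "1 - freq_response h \<omega> \<noteq> 0"
    and le: "\<And>i e. e \<in> {1, -1} \<Longrightarrow>
      h i * cos (of_int e * pi / of_int N - \<omega> * of_int i) \<le> \<bar>h i\<bar> * cos (pi / of_int N)"
  shows "\<bar>Arg (1 - freq_response h \<omega>)\<bar> \<le> pi / 2 - pi / of_int N"
proof (rule abs_Arg_le_of_half_planes[OF nz])
  have "(2::real) < of_int N" using N by simp
  then show phi: "0 \<le> pi / of_int N" "pi / of_int N < pi / 2"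
    by (auto simp: field_simps)
  then have c: "0 \<le> cos (pi / of_int N)"
    by (intro cos_ge_zero) auto
  show "0 \<le> Re ((1 - freq_response h \<omega>) * cis (pi / of_int N))"
    using c le[of 1] by (intro Re_one_minus_freq_response_nonneg l1) auto
  show "0 \<le> Re ((1 - freq_response h \<omega>) * cis (- (pi / of_int N)))"
    using c le[of "- 1"] by (intro Re_one_minus_freq_response_nonneg l1) auto
qed

lemma abs_Arg_nonneg_multiplier_even_le:
  fixes \<alpha> \<beta> :: nat
  assumes l1: "l1_norm_le_one h" and nonneg: "\<And>i. 0 \<le> h i"
    and "even \<alpha>" and "2 < \<beta>" and nz: "1 - freq_response h (real \<alpha> / real \<beta> * pi) \<noteq> 0"
  shows "\<bar>Arg (1 - freq_response h (real \<alpha> / real \<beta> * pi))\<bar> \<le> pi / 2 * (1 - 2 / real \<beta>)"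
proof -
  have "\<bar>Arg (1 - freq_response h (real \<alpha> / real \<beta> * pi))\<bar> \<le> pi / 2 - pi / of_int (int \<beta>)"
  proof (rule abs_Arg_one_minus_freq_response_le[OF l1 _ nz])
    fix i e :: int
    assume "e \<in> {1, -1}"
    \<comment> \<open>Parity decides: \<open>e\<close> is odd and \<open>int \<alpha> * i\<close> is
      even, so the difference is odd.\<close>
    then have "\<not> 2 * int \<beta> dvd e - int \<alpha> * i"
      using \<open>even \<alpha>\<close> by (auto dest!: dvd_mult_left)
    then have "cos (of_int (e - int \<alpha> * i) * pi / of_int (int \<beta>)) \<le> cos (pi / of_int (int \<beta>))"
      using assms(4) by (intro cos_int_multiple_le) auto
    moreover have "of_int e * pi / of_int (int \<beta>) - real \<alpha> / real \<beta> * pi * of_int i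
        = of_int (e - int \<alpha> * i) * pi / of_int (int \<beta>)"
      by (simp add: diff_divide_distrib left_diff_distrib)
    ultimately show "h i * cos (of_int e * pi / of_int (int \<beta>) - real \<alpha> / real \<beta> * pi * of_int i)
        \<le> \<bar>h i\<bar> * cos (pi / of_int (int \<beta>))"
      using nonneg[of i] by (simp add: mult_left_mono)
  qed (use assms(4) in auto)
  then show ?thesis by (simp add: algebra_simps)
qed

lemma abs_Arg_signed_multiplier_le:
  fixes \<alpha> \<beta> :: nat
  assumes l1: "l1_norm_le_one h"
    and "1 < \<beta>" and nz: "1 - freq_response h (real \<alpha> / real \<beta> * pi) \<noteq> 0"
  shows "\<bar>Arg (1 - freq_response h (real \<alpha> / real \<beta> * pi))\<bar> \<le> pi / 2 * (1 - 1 / real \<beta>)"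
proof -
  let ?N = "2 * int \<beta>"
  have "\<bar>Arg (1 - freq_response h (real \<alpha> / real \<beta> * pi))\<bar> \<le> pi / 2 - pi / of_int ?N"
  proof (rule abs_Arg_one_minus_freq_response_le[OF l1 _ nz])
    fix i e :: int
    assume e: "e \<in> {1, -1}"
    define x where "x = of_int e * pi / of_int ?N - real \<alpha> / real \<beta> * pi * of_int i"
    define n where "n = e - 2 * int \<alpha> * i"
    \<comment> \<open>A negative \<open>h i\<close> turns the root of unity by pi. Over the
      denominator \<open>2 * \<beta>\<close> this adds the even number \<open>?N\<close> to the
      numerator \<open>n\<close>, which therefore stays odd.\<close>
    have x: "x = of_int n * pi / of_int ?N" "x + pi = of_int (n + ?N) * pi / of_int ?N"
      using assms(2) by (auto simp: x_def n_def field_simps)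
    have "odd n" using e by (auto simp: n_def)
    then have "\<not> 2 * ?N dvd n" "\<not> 2 * ?N dvd n + ?N"
      using dvd_mult_left[of 2 ?N n] dvd_mult_left[of 2 ?N "n + ?N"] by auto
    then have "cos x \<le> cos (pi / of_int ?N)" "cos (x + pi) \<le> cos (pi / of_int ?N)"
      using cos_int_multiple_le[of ?N n, folded x(1)]
        cos_int_multiple_le[of ?N "n + ?N", folded x(2)] assms(2)
      by simp_all
    \<comment> \<open>Here \<open>cos (x + pi) = - cos x\<close> supplies the lower bound.\<close>
    then have "\<bar>cos x\<bar> \<le> cos (pi / of_int ?N)" by (simp add: abs_le_iff)
    then have "\<bar>h i\<bar> * \<bar>cos x\<bar> \<le> \<bar>h i\<bar> * cos (pi / of_int ?N)"
      by (intro mult_left_mono) auto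
    then show "h i * cos x \<le> \<bar>h i\<bar> * cos (pi / of_int ?N)"
      using abs_ge_self[of "h i * cos x"] by (simp only: abs_mult)
  qed (use assms(2) in auto)
  then show ?thesis by (simp add: algebra_simps)
qed

lemma Arg_one_minus_freq_response_pi:
  assumes l1: "l1_norm_le_one h"
  shows "Arg (1 - freq_response h pi) = 0"
proof -
  let ?w = "1 - freq_response h pi"
  have s: "sin (pi * of_int i) = 0" for i
    by (metis mult.commute sin_times_pi_eq_0 Ints_of_int)
  have "0 \<le> Re (?w * cis 0)"
  proof (rule Re_one_minus_freq_response_nonneg[OF l1])
    fix i :: int
    have "h i * cos (0 - pi * of_int i) \<le> \<bar>h i\<bar> * \<bar>cos (0 - pi * of_int i)\<bar>"
      by (metis abs_ge_self abs_mult)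
    also have "\<dots> \<le> \<bar>h i\<bar> * 1" by (intro mult_left_mono) auto
    finally show "h i * cos (0 - pi * of_int i) \<le> \<bar>h i\<bar> * cos 0" by simp
  qed simp
  \<comment> \<open>Rotations by a quarter turn both ways bound the imaginary part from above and
    below by 0; every term vanishes because \<open>sin (pi * of_int i) = 0\<close>.\<close>
  moreover have "0 \<le> Re (?w * cis (pi / 2))"
    by (rule Re_one_minus_freq_response_nonneg[OF l1]) (auto simp: cos_diff s)
  moreover have "0 \<le> Re (?w * cis (- pi / 2))"
    by (rule Re_one_minus_freq_response_nonneg[OF l1]) (auto simp: cos_diff s)
  ultimately have "0 \<le> Re ?w" "Im ?w = 0" by auto
  then have "?w = of_real (Re ?w)" by (simp add: complex_eq_iff)
  \<comment> \<open>\<open>Arg\<close> is 0 on nonnegative reals, including 0 by the convention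
    \<open>Arg 0 = 0\<close>.\<close>
  then show ?thesis using \<open>0 \<le> Re ?w\<close> by (metis Arg_of_real not_less)
qed

theorem theorem5:
  fixes \<alpha> \<beta> :: nat and \<omega>\<^sub>1 :: real
  assumes "0 < \<alpha>" and "0 < \<beta>" and "gcd \<alpha> \<beta> = 1" and "\<alpha> < \<beta>"
    and "\<omega>\<^sub>1 = real \<alpha> / real \<beta> * pi"
  shows "(\<forall>M \<in> ZF_multipliers. M (exp (\<i> * complex_of_real \<omega>\<^sub>1)) \<noteq> 0 \<longrightarrow>
           (odd \<alpha> \<longrightarrow> \<bar>Arg (M (exp (\<i> * complex_of_real \<omega>\<^sub>1)))\<bar> \<le> pi / 2 * (1 - 1 / real \<beta>)) \<and>
           (even \<alpha> \<longrightarrow> \<bar>Arg (M (exp (\<i> * complex_of_real \<omega>\<^sub>1)))\<bar> \<le> pi / 2 * (1 - 2 / real \<beta>))) \<and>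
         (\<forall>M \<in> ZF_multipliers_odd. M (exp (\<i> * complex_of_real \<omega>\<^sub>1)) \<noteq> 0 \<longrightarrow>
           \<bar>Arg (M (exp (\<i> * complex_of_real \<omega>\<^sub>1)))\<bar> \<le> pi / 2 * (1 - 1 / real \<beta>)) \<and>
         (\<forall>M \<in> ZF_multipliers_odd. M (exp (\<i> * complex_of_real pi)) \<noteq> 0 \<longrightarrow>
           Arg (M (exp (\<i> * complex_of_real pi))) = 0)"
proof (intro conjI ballI impI)
  have \<beta>: "1 < \<beta>" using assms by linarith
  fix M
  {
    assume M: "M \<in> ZF_multipliers" and nz: "M (exp (\<i> * complex_of_real \<omega>\<^sub>1)) \<noteq> 0"
    obtain h where "l1_norm_le_one h" "\<And>i. 0 \<le> h i"
        "M (exp (\<i> * complex_of_real \<omega>\<^sub>1)) = 1 - freq_response h \<omega>\<^sub>1"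
      using M unfolding ZF_multipliers_def by blast
    note h = this
    \<comment> \<open>For odd \<alpha> the bound is the one for signed \<open>h\<close>.\<close>
    show "\<bar>Arg (M (exp (\<i> * complex_of_real \<omega>\<^sub>1)))\<bar> \<le> pi / 2 * (1 - 1 / real \<beta>)"
      using abs_Arg_signed_multiplier_le[OF h(1) \<beta>, of \<alpha>, folded assms(5)] nz unfolding h(3) by blast
    assume "even \<alpha>"
    \<comment> \<open>A positive even \<alpha> is at least 2 and lies below \<beta>.\<close>
    moreover from this have "2 < \<beta>"
      using assms(1,4) by presburger
    ultimately show "\<bar>Arg (M (exp (\<i> * complex_of_real \<omega>\<^sub>1)))\<bar> \<le> pi / 2 * (1 - 2 / real \<beta>)"
      using abs_Arg_nonneg_multiplier_even_le[OF h(1,2), of \<alpha> \<beta>, folded assms(5)] nz unfolding h(3) by blast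
  next
    assume M: "M \<in> ZF_multipliers_odd"
    then obtain h where l1: "l1_norm_le_one h" and
        h: "\<And>\<omega>::real. M (exp (\<i> * complex_of_real \<omega>)) = 1 - freq_response h \<omega>"
      unfolding ZF_multipliers_odd_def by blast
    show "Arg (M (exp (\<i> * complex_of_real pi))) = 0"
      unfolding h by (rule Arg_one_minus_freq_response_pi[OF l1])
    assume "M (exp (\<i> * complex_of_real \<omega>\<^sub>1)) \<noteq> 0"
    then show "\<bar>Arg (M (exp (\<i> * complex_of_real \<omega>\<^sub>1)))\<bar> \<le> pi / 2 * (1 - 1 / real \<beta>)"
      using abs_Arg_signed_multiplier_le[OF l1 \<beta>, of \<alpha>, folded assms(5)] unfolding h by blast
  }
qed

end
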